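(* Let $\alpha<\beta$ be positive irrationals with $1/\alpha+1/\beta=1$, so that $\{a_n\}_{n\ge0}=\{[n\alpha]\}_{n\ge0}$ and $\{b_n\}_{n\ge0}=\{[n\beta]\}_{n\ge0}$ are complementary Beatty sequences. Then there is a non-negative integer-valued function $f$ such that the Relaxed Wythoff game played with constraint function $f$ has as its $P$-positions precisely the pairs $\{(a_n,b_n)\}_{n=0}^\infty$.
   Context: $[\cdot]$ denotes the floor function. Relaxed Wythoff with integer-valued, non-negative constraint function $f$: a position consists of two piles of tokens and is written $(x,y)$ with $0\le x\le y<\infty$ (the smaller pile is always listed first). Two players alternate; on each turn the player does one of the following. (aa) Remove any positive number of tokens from a single pile, possibly the entire pile. (bb) Remove more tokens from the smaller pile than from the larger pile (a special case of the next move type). (cc) Remove a positive number of tokens from each pile, moving from $(x_0,y_0)$ to $(x_1,y_1)$ (so $0\le x_1<x_0$, $0\le y_1<y_0$), where $(y_0-y_1)-(x_0-x_1)<f(x_0)$. The player who leaves both piles empty wins (normal play). A position is an $N$-position if the player moving from it has a winning strategy, and a $P$-position otherwise. *)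

theory Defs
  imports Complex_Main
begin

type_synonym position = "nat \<times> nat"

definition is_position :: "position \<Rightarrow> bool" where
  "is_position p \<longleftrightarrow> fst p \<le> snd p"

definition arrange :: "nat \<Rightarrow> nat \<Rightarrow> position" where
  "arrange u v = (min u v, max u v)"

text \<open>
  In the two rules that remove tokens from both piles, the resulting position is required to be
  listed with its smaller pile first, as every position is. The lemma below shows that one may
  equally well impose the constraint on the physical piles and rearrange them afterwards.
  Rule \<open>more_from_smaller\<close> is subsumed by \<open>relaxed\<close>, since the values of \<open>f\<close> are non-negative.
\<close>

inductive rw_move :: "(nat \<Rightarrow> nat) \<Rightarrow> position \<Rightarrow> position \<Rightarrow> bool"
  for f :: "nat \<Rightarrow> nat"
where
  single_smaller:
    "\<lbrakk>x0 \<le> y0; x1 < x0\<rbrakk> \<Longrightarrow> rw_move f (x0, y0) (x1, y0)"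
| single_larger:
    "\<lbrakk>x0 \<le> y0; y1 < y0\<rbrakk> \<Longrightarrow> rw_move f (x0, y0) (arrange x0 y1)"
| more_from_smaller:
    "\<lbrakk>x0 \<le> y0; x1 \<le> y1; x1 < x0; y1 < y0; y0 - y1 < x0 - x1\<rbrakk>
      \<Longrightarrow> rw_move f (x0, y0) (x1, y1)"
| relaxed:
    "\<lbrakk>x0 \<le> y0; x1 \<le> y1; x1 < x0; y1 < y0;
      (int y0 - int y1) - (int x0 - int x1) < int (f x0)\<rbrakk>
      \<Longrightarrow> rw_move f (x0, y0) (x1, y1)"

lemma rw_move_relaxed_arrange:
  assumes "x0 \<le> y0" "u < x0" "v < y0"
    and "(int y0 - int v) - (int x0 - int u) < int (f x0)"
  shows "rw_move f (x0, y0) (arrange u v)"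
  using assms by (auto simp: arrange_def min_def max_def intro!: rw_move.relaxed)

text \<open>
  A play is recorded as the non-empty list of positions visited so far, so it consists of
  \<open>length ps - 1\<close> moves. The player moving from the initial position \<open>p\<close> makes the moves
  leading from even indices. Every move removes a token, so there are no infinite plays, and
  \<open>(0, 0)\<close> is the only position without moves.
\<close>

definition is_play :: "(nat \<Rightarrow> nat) \<Rightarrow> position \<Rightarrow> position list \<Rightarrow> bool" where
  "is_play f p ps \<longleftrightarrow> ps \<noteq> [] \<and> hd ps = p \<and> successively (rw_move f) ps"

text \<open>A strategy of the first player may depend on the whole history of the play.\<close>

definition follows :: "(position list \<Rightarrow> position) \<Rightarrow> position list \<Rightarrow> bool" where
  "follows \<sigma> ps \<longleftrightarrow>
     (\<forall>i. even i \<and> Suc i < length ps \<longrightarrow> ps ! Suc i = \<sigma> (take (Suc i) ps))"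

text \<open>
  The strategy must always prescribe a legal move when the first player is to move, and every
  finished play following it must consist of an odd number of moves, i.e. the first player
  is the one who leaves both piles empty.
\<close>

definition winning_strategy ::
  "(nat \<Rightarrow> nat) \<Rightarrow> position \<Rightarrow> (position list \<Rightarrow> position) \<Rightarrow> bool" where
  "winning_strategy f p \<sigma> \<longleftrightarrow>
     (\<forall>ps. is_play f p ps \<and> follows \<sigma> ps \<longrightarrow>
        (if last ps = (0, 0) then odd (length ps - 1)
         else even (length ps - 1) \<longrightarrow> rw_move f (last ps) (\<sigma> ps)))"

definition N_position :: "(nat \<Rightarrow> nat) \<Rightarrow> position \<Rightarrow> bool" where
  "N_position f p \<longleftrightarrow> is_position p \<and> (\<exists>\<sigma>. winning_strategy f p \<sigma>)"

definition P_position :: "(nat \<Rightarrow> nat) \<Rightarrow> position \<Rightarrow> bool" where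
  "P_position f p \<longleftrightarrow> is_position p \<and> \<not> N_position f p"

end

theory Submission
  imports Defs
begin

text \<open>
  Write \<open>d\<^sub>n = b\<^sub>n - a\<^sub>n\<close>. Since \<open>1 < \<alpha> < 2 < \<beta>\<close>, consecutive terms of \<open>a\<close> differ by at most 2 and
  those of \<open>b\<close> by at least 2, so \<open>d\<close> is non-decreasing. Take \<open>f (a\<^sub>n) = d\<^sub>n - d\<^sub>n\<^sub>-\<^sub>1\<close> for \<open>n > 0\<close>, the
  largest value that forbids moves between the pairs \<open>(a\<^sub>n, b\<^sub>n)\<close>: a two-pile move from the \<open>n\<close>-th pair
  to the \<open>m\<close>-th one, \<open>m < n\<close>, lowers the difference of the piles by \<open>d\<^sub>n - d\<^sub>m \<ge> d\<^sub>n - d\<^sub>n\<^sub>-\<^sub>1\<close>, and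
  complementarity excludes the single-pile moves.

  Conversely a position \<open>(x, y)\<close> that is no such pair has a move to one. A single pile suffices if
  \<open>x = b\<^sub>n\<close>, if \<open>x = a\<^sub>n\<close> with \<open>y > b\<^sub>n\<close>, or if \<open>y = b\<^sub>m\<close> for some \<open>m < n\<close>. In the remaining case
  \<open>x = a\<^sub>n\<close> and \<open>b\<^sub>m < y < b\<^sub>m\<^sub>+\<^sub>1\<close> with \<open>m < n\<close>, and the two-pile move to \<open>(a\<^sub>m, b\<^sub>m)\<close> is legal: this
  needs \<open>(y - b\<^sub>m) - (a\<^sub>n - a\<^sub>m) < f (a\<^sub>n)\<close>, which reduces to
  \<open>(b\<^sub>m\<^sub>+\<^sub>1 - b\<^sub>m) - (b\<^sub>n - b\<^sub>n\<^sub>-\<^sub>1) \<le> a\<^sub>n\<^sub>-\<^sub>1 - a\<^sub>m\<close>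
  and holds because two gaps of a Beatty sequence differ by at most 1, while the right-hand
  side is at least 1 unless \<open>m = n - 1\<close>, where the left-hand side vanishes
  (\<open>move_between_b_terms\<close>).

  What is left is general: a set of positions that no move connects internally, and that is
  reachable in one move from every position outside it, is the set of \<open>P\<close>-positions
  (\<open>P_positions_eq_kernel\<close>), and Beatty's theorem on complementary sequences.
\<close>

section \<open>Kernels of the move graph are the sets of P-positions\<close>

lemma rw_move_is_position: "rw_move f p q \<Longrightarrow> is_position q"
  by (induction rule: rw_move.induct) (auto simp: is_position_def arrange_def)

lemma rw_move_decreases_total: "rw_move f p q \<Longrightarrow> fst q + snd q < fst p + snd p"
  by (induction rule: rw_move.induct) (auto simp: arrange_def)

lemma is_play_snoc:
  assumes "ps \<noteq> []"
  shows "is_play f p (ps @ [q]) \<longleftrightarrow> is_play f p ps \<and> rw_move f (last ps) q"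
  using assms by (auto simp: is_play_def successively_append_iff)

lemma follows_snoc:
  assumes "ps \<noteq> []"
  shows "follows \<sigma> (ps @ [q]) \<longleftrightarrow> follows \<sigma> ps \<and> (odd (length ps) \<longrightarrow> q = \<sigma> ps)"
proof -
  obtain k where k: "length ps = Suc k"
    using assms by (cases ps) auto
  have last: "(ps @ [q]) ! Suc k = \<sigma> (take (Suc k) (ps @ [q])) \<longleftrightarrow> q = \<sigma> ps"
    using k by (simp add: nth_append)
  have earlier: "(ps @ [q]) ! Suc i = \<sigma> (take (Suc i) (ps @ [q])) \<longleftrightarrow>
      ps ! Suc i = \<sigma> (take (Suc i) ps)" if "i < k" for i
    using k that by (simp add: nth_append)
  have "follows \<sigma> (ps @ [q]) \<longleftrightarrow>
    (\<forall>i. even i \<and> i < Suc k \<longrightarrow> (ps @ [q]) ! Suc i = \<sigma> (take (Suc i) (ps @ [q])))"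
    by (simp add: follows_def k)
  also have "\<dots> \<longleftrightarrow> (\<forall>i. even i \<and> i < k \<longrightarrow> ps ! Suc i = \<sigma> (take (Suc i) ps)) \<and>
      (even k \<longrightarrow> q = \<sigma> ps)"
    unfolding less_Suc_eq using last earlier by blast
  finally show ?thesis
    by (simp add: follows_def k)
qed

text \<open>
  Whoever can move into a kernel \<open>S\<close> wins by always doing so: the opponent has to leave \<open>S\<close>, and
  the final position \<open>(0, 0)\<close> belongs to \<open>S\<close>.
\<close>

theorem P_positions_eq_kernel:
  assumes position: "\<And>p. p \<in> S \<Longrightarrow> is_position p"
    and stable: "\<And>p q. p \<in> S \<Longrightarrow> rw_move f p q \<Longrightarrow> q \<notin> S"
    and absorbing: "\<And>p. is_position p \<Longrightarrow> p \<notin> S \<Longrightarrow> \<exists>q\<in>S. rw_move f p q"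
  shows "{p. P_position f p} = S"
proof -
  have zero: "(0, 0) \<in> S"
    using absorbing[of "(0, 0)"] rw_move_decreases_total[of f "(0, 0)"]
    by (force simp: is_position_def)
  have N: "N_position f p" if p: "is_position p" "p \<notin> S" for p
  proof -
    define \<sigma> where "\<sigma> ps = (SOME q. q \<in> S \<and> rw_move f (last ps) q)" for ps
    have \<sigma>: "\<sigma> ps \<in> S" "rw_move f (last ps) (\<sigma> ps)" if "is_position (last ps)" "last ps \<notin> S" for ps
    proof -
      have "\<exists>q. q \<in> S \<and> rw_move f (last ps) q"
        using absorbing[OF that] by blast
      from someI_ex[OF this] show "\<sigma> ps \<in> S" "rw_move f (last ps) (\<sigma> ps)"
        unfolding \<sigma>_def by auto
    qed
    have parity: "is_position (last ps) \<and> (last ps \<in> S \<longleftrightarrow> even (length ps))"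
      if "is_play f p ps" "follows \<sigma> ps" for ps
      using that
    proof (induction ps rule: rev_induct)
      case Nil
      then show ?case by (simp add: is_play_def)
    next
      case (snoc q ps)
      show ?case
      proof (cases "ps = []")
        case True
        then show ?thesis using snoc.prems p by (simp add: is_play_def)
      next
        case False
        then have *: "is_play f p ps" "follows \<sigma> ps" "rw_move f (last ps) q"
          "odd (length ps) \<Longrightarrow> q = \<sigma> ps"
          using snoc.prems by (auto simp: is_play_snoc follows_snoc)
        show ?thesis
          using snoc.IH[OF *(1,2)] *(3,4) \<sigma>(1)[of ps] stable[of "last ps" q]
            rw_move_is_position[of f "last ps" q] by auto
      qed
    qed
    have "winning_strategy f p \<sigma>"
      unfolding winning_strategy_def
    proof (intro allI impI)
      fix ps assume ps: "is_play f p ps \<and> follows \<sigma> ps"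
      then have "ps \<noteq> []" by (simp add: is_play_def)
      then show "if last ps = (0, 0) then odd (length ps - 1)
         else even (length ps - 1) \<longrightarrow> rw_move f (last ps) (\<sigma> ps)"
        using parity[of ps] ps zero \<sigma>(2)[of ps] by auto
    qed
    with p show ?thesis by (auto simp: N_position_def)
  qed
  have not_N: "\<not> N_position f p" if p: "p \<in> S" for p
  proof
    assume "N_position f p"
    then obtain \<sigma> where \<sigma>: "winning_strategy f p \<sigma>"
      by (auto simp: N_position_def)
    \<comment> \<open>The second player answers every move back into \<open>S\<close>, so a play in which the first player
      uses \<open>\<sigma>\<close> and is to move in \<open>S\<close> could be prolonged for ever.\<close>
    have False if "is_play f p ps" "follows \<sigma> ps" "last ps \<in> S" "odd (length ps)" for ps
      using that
    proof (induction "fst (last ps) + snd (last ps)" arbitrary: ps rule: less_induct)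
      case less
      have ne: "ps \<noteq> []" using less.prems(1) by (simp add: is_play_def)
      define q where "q = \<sigma> ps"
      have q: "rw_move f (last ps) q"
        using \<sigma> less.prems unfolding winning_strategy_def q_def
        by (auto split: if_splits)
      then have "q \<notin> S" "is_position q"
        using stable less.prems(3) rw_move_is_position by blast+
      then obtain r where r: "r \<in> S" "rw_move f q r"
        using absorbing by blast
      have "is_play f p (ps @ [q])" "follows \<sigma> (ps @ [q])"
        using less.prems ne q by (simp_all add: is_play_snoc follows_snoc q_def)
      then have "is_play f p ((ps @ [q]) @ [r])" "follows \<sigma> ((ps @ [q]) @ [r])"
        using less.prems(4) r(2) is_play_snoc[of "ps @ [q]"] follows_snoc[of "ps @ [q]"]
        by simp_all
      then show False
        using less.hyps[of "(ps @ [q]) @ [r]"] less.prems(4) r(1)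
          rw_move_decreases_total[OF q] rw_move_decreases_total[OF r(2)] by simp
    qed
    from this[of "[p]"] p show False
      by (simp add: is_play_def follows_def)
  qed
  show ?thesis
    using N not_N position by (auto simp: P_position_def)
qed

section \<open>Complementary sequences with balanced gaps\<close>

text \<open>
  The properties of a complementary pair of Beatty sequences on which the game depends. The index 0
  carries the value 0 in both sequences, which is therefore the only common value. By \<open>balanced\<close>,
  any two gaps of \<open>b\<close> differ by at most 1.
\<close>

locale balanced_complementary_pair =
  fixes a b :: "nat \<Rightarrow> nat"
  assumes zero: "a 0 = 0" "b 0 = 0"
    and a_strict_mono: "strict_mono a"
    and a_gap: "a (Suc n) \<le> a n + 2"
    and b_gap: "b n + 2 \<le> b (Suc n)"
    and balanced: "b (Suc i) + b j \<le> b i + b (Suc j) + 1"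
    and disjoint: "a i = b j \<Longrightarrow> j = 0"
    and cover: "x \<in> range a \<union> range b"
begin

definition pairs :: "position set" where
  "pairs = range (\<lambda>n. (a n, b n))"

definition diff :: "nat \<Rightarrow> nat" where
  "diff n = b n - a n"

text \<open>
  At \<open>x = a n\<close>, the smaller pile of a pair, \<open>inv a x\<close> is the index \<open>n\<close>, and the value is the
  increment of \<open>diff\<close> leading to \<open>n\<close>; it is 0 for \<open>n = 0\<close>, as \<open>0 - 1 = 0\<close>.
\<close>

definition constraint :: "nat \<Rightarrow> nat" where
  "constraint x = diff (inv a x) - diff (inv a x - 1)"

lemma b_strict_mono: "strict_mono b"
proof (rule strict_mono_Suc_iff[THEN iffD2], rule allI)
  show "b n < b (Suc n)" for n
    using b_gap[of n] by simp
qed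

lemma a_eq_iff [simp]: "a m = a n \<longleftrightarrow> m = n"
  using a_strict_mono by (simp add: strict_mono_eq)

lemma b_eq_iff [simp]: "b m = b n \<longleftrightarrow> m = n"
  using b_strict_mono by (simp add: strict_mono_eq)

lemma a_less_iff [simp]: "a m < a n \<longleftrightarrow> m < n"
  using a_strict_mono by (simp add: strict_mono_less)

lemma b_less_iff [simp]: "b m < b n \<longleftrightarrow> m < n"
  using b_strict_mono by (simp add: strict_mono_less)

lemma a_le_b: "a n \<le> b n"
proof (induction n)
  case (Suc n)
  then show ?case using a_gap[of n] b_gap[of n] by linarith
qed (simp add: zero)

lemma b_eq_a_plus_diff: "b n = a n + diff n"
  using a_le_b[of n] by (simp add: diff_def)

lemma diff_mono: "mono diff"
proof (rule mono_iff_le_Suc[THEN iffD2], rule allI)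
  show "diff n \<le> diff (Suc n)" for n
    using a_gap[of n] b_gap[of n] b_eq_a_plus_diff[of n] b_eq_a_plus_diff[of "Suc n"] by linarith
qed

lemma constraint_a: "constraint (a n) = diff n - diff (n - 1)"
  using a_strict_mono by (simp add: constraint_def strict_mono_imp_inj_on)

lemma diff_plus_constraint_le:
  assumes "m < n"
  shows "diff m + constraint (a n) \<le> diff n"
proof -
  have "diff m \<le> diff (n - 1)" "diff (n - 1) \<le> diff n"
    using assms by (auto intro: monoD[OF diff_mono])
  then show ?thesis by (simp add: constraint_a)
qed

lemma no_move_between_pairs:
  assumes "p \<in> pairs" "rw_move constraint p q"
  shows "q \<notin> pairs"
proof
  assume "q \<in> pairs"
  then obtain m where m: "q = (a m, b m)" by (auto simp: pairs_def)
  obtain n where n: "p = (a n, b n)" using assms(1) by (auto simp: pairs_def)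
  from assms(2) show False
    unfolding m n
  proof cases
    case (single_larger y1)
    then show False
      using disjoint[of n m] zero by (auto simp: arrange_def min_def max_def split: if_splits)
  next
    case more_from_smaller
    then have "diff m \<le> diff n" by (intro monoD[OF diff_mono]) simp
    with more_from_smaller show False
      using b_eq_a_plus_diff[of m] b_eq_a_plus_diff[of n] by linarith
  next
    case relaxed
    then have "m < n" by simp
    with relaxed show False
      using diff_plus_constraint_le[of m n] b_eq_a_plus_diff[of m] b_eq_a_plus_diff[of n]
      by linarith
  qed auto
qed

text \<open>
  The difference \<open>y - a\<^sub>n\<close> is largest for \<open>y = b\<^sub>m\<^sub>+\<^sub>1 - 1\<close>. The gap of \<open>b\<close> before \<open>b\<^sub>m\<^sub>+\<^sub>1\<close> may exceed the
  one before \<open>b\<^sub>n\<close>, which enters into the constraint, but by at most 1; if it does, then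
  \<open>m < n - 1\<close>, and the growth of \<open>a\<close> from \<open>a\<^sub>m\<close> to \<open>a\<^sub>n\<^sub>-\<^sub>1\<close> compensates it.
\<close>

lemma move_between_b_terms:
  assumes "m < n" "a n \<le> y" "b m < y" "y < b (Suc m)"
  shows "rw_move constraint (a n, y) (a m, b m)"
proof (rule rw_move.relaxed)
  obtain k where k: "n = Suc k" "m \<le> k" using assms(1) by (cases n) auto
  have "b (Suc m) + b k \<le> b m + b n + (a k - a m)"
  proof (cases "m = k")
    case False
    then have "a m < a k" using k(2) by simp
    with balanced[of m k] show ?thesis unfolding k(1) by linarith
  qed (use k in auto)
  moreover have "a m \<le> a k" "a m < a n"
    using k a_strict_mono by (auto simp: strict_mono_less_eq)
  moreover have "diff k + constraint (a n) = diff n"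
    using k monoD[OF diff_mono, of k n] by (simp add: constraint_a)
  ultimately show "int y - int (b m) - (int (a n) - int (a m)) < int (constraint (a n))"
    using assms b_eq_a_plus_diff[of k] b_eq_a_plus_diff[of n] by linarith
qed (use assms a_le_b in auto)

lemma move_to_pairs:
  assumes "x \<le> y" "(x, y) \<notin> pairs"
  shows "\<exists>q\<in>pairs. rw_move constraint (x, y) q"
proof -
  have pair: "(a n, b n) \<in> pairs" for n by (auto simp: pairs_def)
  have larger: "rw_move constraint (x, y) (u, v)"
    if "arrange x w = (u, v)" "w < y" for u v w
    using rw_move.single_larger[OF assms(1) that(2), of constraint] that(1) by simp
  show ?thesis
  proof (cases "x \<in> range a")
    case False
    then obtain n where n: "x = b n" using cover[of x] by auto
    with False have "b n \<noteq> a n" by auto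
    then have "a n < b n" using a_le_b[of n] by simp
    then have "rw_move constraint (x, y) (a n, b n)"
      using assms(1) n by (intro larger[of "a n"]) (auto simp: arrange_def)
    then show ?thesis using pair by blast
  next
    case True
    then obtain n where n: "x = a n" by auto
    then have "y \<noteq> b n" using assms(2) pair by auto
    then consider "b n < y" | "y < b n" by linarith
    then show ?thesis
    proof cases
      case 1
      then have "rw_move constraint (x, y) (a n, b n)"
        using n a_le_b[of n] by (intro larger[of "b n"]) (auto simp: arrange_def)
      then show ?thesis using pair by blast
    next
      case 2
      \<comment> \<open>The index \<open>m\<close> for which \<open>b\<^sub>m \<le> y < b\<^sub>m\<^sub>+\<^sub>1\<close>.\<close>
      obtain m where m: "\<not> y < b m" "y < b (Suc m)" "m < n"
      proof -
        define k where "k = (LEAST i. y < b i)"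
        have k: "y < b k" "k \<le> n"
          using LeastI[of "\<lambda>i. y < b i" n] Least_le[of "\<lambda>i. y < b i" n] 2 by (simp_all add: k_def)
        then have "k \<noteq> 0" using zero by (cases k) auto
        then obtain i where i: "k = Suc i" by (cases k) auto
        then have "\<not> y < b i"
          using not_less_Least[of i "\<lambda>i. y < b i"] by (simp add: k_def)
        then show ?thesis using that k i by auto
      qed
      show ?thesis
      proof (cases "y = b m")
        case True
        then have "rw_move constraint (x, y) (a m, b m)"
          using rw_move.single_smaller[OF assms(1), of "a m"] n m(3) by simp
        then show ?thesis using pair by blast
      next
        case False
        then have "rw_move constraint (x, y) (a m, b m)"
          unfolding n using m assms(1) n by (intro move_between_b_terms) auto
        then show ?thesis using pair by blast
      qed
    qed
  qed
qed

theorem P_positions_constraint: "{p. P_position constraint p} = pairs"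
proof (rule P_positions_eq_kernel)
  show "is_position p" if "p \<in> pairs" for p
    using that a_le_b by (auto simp: pairs_def is_position_def)
  show "q \<notin> pairs" if "p \<in> pairs" "rw_move constraint p q" for p q
    using no_move_between_pairs that .
  show "\<exists>q\<in>pairs. rw_move constraint p q" if "is_position p" "p \<notin> pairs" for p
    using that move_to_pairs[of "fst p" "snd p"] by (simp add: is_position_def)
qed

end

section \<open>Beatty sequences\<close>

definition beatty :: "real \<Rightarrow> nat \<Rightarrow> nat" where
  "beatty r n = nat \<lfloor>real n * r\<rfloor>"

lemma beatty_eq_iff:
  assumes "0 < r"
  shows "beatty r n = k \<longleftrightarrow> real k \<le> real n * r \<and> real n * r < real k + 1"
proof -
  have "0 \<le> \<lfloor>real n * r\<rfloor>" using assms by simp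
  then have "beatty r n = k \<longleftrightarrow> \<lfloor>real n * r\<rfloor> = int k"
    unfolding beatty_def by linarith
  then show ?thesis by (simp add: floor_eq_iff)
qed

lemma beatty_bounds:
  assumes "0 < r"
  shows "real (beatty r n) \<le> real n * r" "real n * r < real (beatty r n) + 1"
  using beatty_eq_iff[OF assms, of n "beatty r n"] by auto

lemma beatty_zero [simp]: "beatty r 0 = 0"
  by (simp add: beatty_def)

lemma beatty_gap_ge:
  assumes "0 < r" "real k \<le> r"
  shows "beatty r n + k \<le> beatty r (Suc n)"
  using beatty_bounds(1)[OF assms(1), of n] beatty_bounds(2)[OF assms(1), of "Suc n"] assms(2)
  by (simp add: algebra_simps)

lemma beatty_gap_le:
  assumes "0 < r" "r \<le> real k"
  shows "beatty r (Suc n) \<le> beatty r n + k"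
  using beatty_bounds(2)[OF assms(1), of n] beatty_bounds(1)[OF assms(1), of "Suc n"] assms(2)
  by (simp add: algebra_simps)

lemma beatty_balanced:
  assumes "0 < r"
  shows "beatty r (Suc i) + beatty r j \<le> beatty r i + beatty r (Suc j) + 1"
proof -
  have "real (beatty r (Suc i)) < real (beatty r i) + 1 + r"
    using beatty_bounds(2)[OF assms, of i] beatty_bounds(1)[OF assms, of "Suc i"]
    by (simp add: algebra_simps)
  moreover have "real (beatty r j) + r < real (beatty r (Suc j)) + 1"
    using beatty_bounds(1)[OF assms, of j] beatty_bounds(2)[OF assms, of "Suc j"]
    by (simp add: algebra_simps)
  ultimately show ?thesis by linarith
qed

lemma irrational_multiple_neq_nat:
  fixes r :: real
  assumes "r \<notin> \<rat>" "0 < k"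
  shows "real n * r \<noteq> real k"
proof
  assume *: "real n * r = real k"
  then have "n \<noteq> 0" using assms(2) by (cases n) auto
  with * have "r = real k / real n" by (simp add: field_simps)
  then show False using assms(1) by simp
qed

text \<open>
  A common value \<open>k > 0\<close> means \<open>k < i r < k + 1\<close>, where irrationality makes the first inequality
  strict, and \<open>k \<le> j s < k + 1\<close>. Dividing by \<open>r\<close> and \<open>s\<close> and adding gives \<open>k < i + j < k + 1\<close>, as
  \<open>1/r + 1/s = 1\<close>.
\<close>

lemma beatty_disjoint:
  assumes "0 < r" "0 < s" "r \<notin> \<rat>" "1 / r + 1 / s = 1" "beatty r i = beatty s j"
  shows "beatty s j = 0"
proof (rule ccontr)
  define k where "k = beatty s j"
  assume "beatty s j \<noteq> 0"
  then have "0 < k" by (simp add: k_def)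
  then have "real k < real i * r"
    using beatty_bounds(1)[OF assms(1), of i] irrational_multiple_neq_nat[OF assms(3), of k i]
      assms(5) by (simp add: k_def)
  then have "real k * (1 / r) < real i" "real i < (real k + 1) * (1 / r)"
    using beatty_bounds(2)[OF assms(1), of i] assms(1,5) by (auto simp: k_def field_simps)
  moreover have "real k * (1 / s) \<le> real j" "real j < (real k + 1) * (1 / s)"
    using beatty_bounds[OF assms(2), of j] assms(2) by (auto simp: k_def field_simps)
  moreover have "real k * (1 / r) + real k * (1 / s) = real k"
    "(real k + 1) * (1 / r) + (real k + 1) * (1 / s) = real k + 1"
    using assms(4) by (simp_all only: distrib_left[symmetric] mult_1_right)
  ultimately have "real k < real (i + j)" "real (i + j) < real (Suc k)"
    unfolding of_nat_add of_nat_Suc by linarith+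
  then show False unfolding of_nat_less_iff by simp
qed

lemma beatty_skips:
  assumes "0 < r" "k \<notin> range (beatty r)"
  obtains i where "real i * r < real k" "real k + 1 \<le> (real i + 1) * r"
proof -
  define i where "i = nat \<lfloor>real k / r\<rfloor>"
  have "0 \<le> \<lfloor>real k / r\<rfloor>" using assms(1) by simp
  then have "real i \<le> real k / r" "real k / r < real i + 1"
    unfolding i_def by linarith+
  then have i: "real i * r \<le> real k" "real k < (real i + 1) * r"
    using assms(1) by (simp_all add: field_simps)
  have "beatty r i \<noteq> k" "beatty r (Suc i) \<noteq> k"
    using assms(2) by auto
  then show ?thesis
    using i that[of i] assms(1) by (simp add: beatty_eq_iff algebra_simps)
qed

text \<open>
  A missed value \<open>k\<close> satisfies \<open>i r < k\<close> and \<open>k + 1 < (i + 1) r\<close>, strict by irrationality, and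
  similarly for \<open>s\<close>. Adding after division by \<open>r\<close> and \<open>s\<close> gives \<open>i + j < k < i + j + 1\<close>.
\<close>

lemma beatty_cover:
  assumes "0 < r" "0 < s" "r \<notin> \<rat>" "1 / r + 1 / s = 1"
  shows "k \<in> range (beatty r) \<union> range (beatty s)"
proof (rule ccontr)
  assume k: "\<not> ?thesis"
  then obtain i where i: "real i * r < real k" "real k + 1 \<le> (real i + 1) * r"
    using beatty_skips[OF assms(1)] by blast
  obtain j where j: "real j * s < real k" "real k + 1 \<le> (real j + 1) * s"
    using beatty_skips[OF assms(2)] k by blast
  have "real k + 1 \<noteq> (real i + 1) * r"
    using irrational_multiple_neq_nat[OF assms(3), of "Suc k" "Suc i"] by (simp add: ac_simps)
  then have "real i < real k * (1 / r)" "(real k + 1) * (1 / r) < real i + 1"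
    using i assms(1) by (auto simp: field_simps)
  moreover have "real j < real k * (1 / s)" "(real k + 1) * (1 / s) \<le> real j + 1"
    using j assms(2) by (auto simp: field_simps)
  moreover have "real k * (1 / r) + real k * (1 / s) = real k"
    "(real k + 1) * (1 / r) + (real k + 1) * (1 / s) = real k + 1"
    using assms(4) by (simp_all only: distrib_left[symmetric] mult_1_right)
  ultimately have "real (i + j) < real k" "real k < real (Suc (i + j))"
    unfolding of_nat_add of_nat_Suc by linarith+
  then show False unfolding of_nat_less_iff by simp
qed

lemma balanced_complementary_pair_beatty:
  assumes "0 < \<alpha>" "\<alpha> < \<beta>" "\<alpha> \<notin> \<rat>" "1 / \<alpha> + 1 / \<beta> = 1"
  shows "balanced_complementary_pair (beatty \<alpha>) (beatty \<beta>)"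
proof -
  have \<beta>: "0 < \<beta>" using assms by simp
  have inv: "1 / \<beta> < 1 / \<alpha>" "0 < 1 / \<beta>"
    using assms by (auto intro: divide_strict_left_mono)
  have "1 / \<alpha> < 1" "1 / 2 < 1 / \<alpha>" "1 / \<beta> < 1 / 2"
    using inv assms(4) by linarith+
  then have bounds: "1 \<le> \<alpha>" "\<alpha> \<le> 2" "2 \<le> \<beta>"
    using assms(1) \<beta> by (simp_all add: field_simps)
  show ?thesis
  proof
    show "strict_mono (beatty \<alpha>)"
      using beatty_gap_ge[of \<alpha> 1] assms(1) bounds by (auto simp: strict_mono_Suc_iff Suc_le_eq)
    show "beatty \<alpha> (Suc n) \<le> beatty \<alpha> n + 2" for n
      using assms(1) bounds by (intro beatty_gap_le) auto
    show gap: "beatty \<beta> n + 2 \<le> beatty \<beta> (Suc n)" for n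
      using \<beta> bounds by (intro beatty_gap_ge) auto
    show "beatty \<beta> (Suc i) + beatty \<beta> j \<le> beatty \<beta> i + beatty \<beta> (Suc j) + 1" for i j
      using \<beta> by (rule beatty_balanced)
    show "j = 0" if "beatty \<alpha> i = beatty \<beta> j" for i j
      using beatty_disjoint[OF assms(1) \<beta> assms(3,4) that] gap[of "j - 1"] by (cases j) auto
    show "x \<in> range (beatty \<alpha>) \<union> range (beatty \<beta>)" for x
      using assms(1) \<beta> assms(3,4) by (rule beatty_cover)
  qed simp_all
qed

section \<open>Relaxed Wythoff games for complementary Beatty sequences\<close>

theorem corollary1:
  fixes \<alpha> \<beta> :: real
  assumes "0 < \<alpha>" and "0 < \<beta>" and "\<alpha> < \<beta>"
    and "\<alpha> \<notin> \<rat>" and "\<beta> \<notin> \<rat>"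
    and "1 / \<alpha> + 1 / \<beta> = 1"
  shows "\<exists>f :: nat \<Rightarrow> nat.
    {p. P_position f p} = range (\<lambda>n :: nat. (nat \<lfloor>real n * \<alpha>\<rfloor>, nat \<lfloor>real n * \<beta>\<rfloor>))"
proof -
  interpret balanced_complementary_pair "beatty \<alpha>" "beatty \<beta>"
    using assms by (intro balanced_complementary_pair_beatty)
  show ?thesis
    using P_positions_constraint by (auto simp: pairs_def beatty_def)
qed

end
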